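(* Let $h$ be the involution on labeled $\beta(1,0)$-trees defined recursively by $h(1,x)=(1,x)$, $h(\lambda((i,x),t))=\gamma((i,x),h(t))$, and $h(u\oplus v)=h(v)\oslash h(u)$. Then on labeled $\beta(1,0)$-trees with at least one edge, $h$ sends the tuple of word-valued statistics $(\mathtt{leaves},\mathtt{int},\mathtt{root},\mathtt{rpath},\mathtt{sub},\mathtt{rsub})$ to $(\mathtt{int},\mathtt{leaves},\mathtt{rpath},\mathtt{root},\mathtt{rsub},\mathtt{sub})$; that is, for every labeled $\beta(1,0)$-tree $t$ with at least one edge, $$\mathtt{leaves}\,t=\mathtt{int}\,h(t),\quad \mathtt{int}\,t=\mathtt{leaves}\,h(t),\quad \mathtt{root}\,t=\mathtt{rpath}\,h(t),$$ $$\mathtt{rpath}\,t=\mathtt{root}\,h(t),\quad \mathtt{sub}\,t=\mathtt{rsub}\,h(t),\quad \mathtt{rsub}\,t=\mathtt{sub}\,h(t).$$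
   Context: A $\beta(1,0)$-tree is a rooted plane tree (children of each node are linearly ordered left to right) whose nodes are labeled with positive integers such that: (1) leaves have label $1$; (2) the root has label equal to the sum of its children's labels; (3) any other non-leaf node has label no greater than the sum of its children's labels. The single-node tree with label $1$ is allowed (it is exempt from (2)). A labeled $\beta(1,0)$-tree is a $\beta(1,0)$-tree in which each node additionally carries a name (a letter of some alphabet), distinct nodes having distinct names; a node with integer label $i$ and name $x$ is written $(i,x)$, and $(1,x)$ also denotes the single-node tree with name $x$. $\operatorname{root} t$ is the integer label of the root. The right path of $t$ is the path from the root to the rightmost leaf (always go to the last child); $\operatorname{rpath} t$ is its number of edges. Operations on labeled $\beta(1,0)$-trees: - $u\oplus v$, for $u,v$ having at least one edge, whose roots have the same name and whose names are otherwise disjoint: identify the roots; the root of $u\oplus v$ keeps the common name and has integer label $\operatorname{root}u+\operatorname{root}v$, and the subtrees at the root are those of $u$ followed by those of $v$. - $\lambda((i,x),t)$, for $1\le i\le\operatorname{root}t$ and $x$ a name not in $t$: add a new root named $x$ whose only child is the old root; the new and the old root both get integer label $i$. - $u\oslash v$, for $u,v$ having at least one edge: identify the rightmost leaf of $u$ with the root of $v$; the identified node gets integer label $1$ and the name of the root of $v$ (the name of the rightmost leaf of $u$ is discarded); everything else is kept. The remaining names are assumed distinct. - $\gamma((i,x),t)$, for $t$ with at least one edge, $1\le i\le\operatorname{rpath}t$, and $x$ a name not in $t$: let $y$ be the $i$th node on the right path of $t$ (the root being the first); attach to $y$ a new last child, a leaf with integer label $1$ and name $x$, and add $1$ to the integer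 label of each node on the path from the root to $y$ (inclusive). By convention, $\gamma((1,x),(1,y))$ is the two-node tree with root $(1,y)$ and child $(1,x)$. The operations $\oplus$ and $\oslash$ are associative. Each labeled tree is of exactly one of the forms $(1,x)$, $\lambda((i,x),t)$, $u\oplus v$, and each tree with at least one edge is uniquely a $\oplus$-sum of one or more trees of the form $\lambda((i,x),s)$; so the recursion determines $h$. Statistics. $\mathtt{v}(t)$ is the word of names of the nodes of $t$ in preorder (root first, then subtrees from left to right); $w^r$ is the reverse of a word $w$. For a labeled $\beta(1,0)$-tree $t$ with at least one edge: - $\mathtt{leaves}\,t$ is the subword of $\mathtt{v}(t)$ consisting of the names of leaves. - $\mathtt{int}\,t$ is the subword of $\mathtt{v}(t)^r$ consisting of the names of internal (non-leaf) nodes. - $\mathtt{rpath}\,t$ is the subword of $\mathtt{v}(t)^r$ consisting of the names of the nodes on the right path, excluding the rightmost leaf. - $\mathtt{root}\,t$ is the subword of $\mathtt{leaves}\,t$ of length $\operatorname{root}t$ found by starting at the root and greedily and recursively searching for $\operatorname{root} t$ leaves in its subtrees, starting from the rightmost subtree and never searching for more leaves in a subtree than the integer label of the root of that subtree. Formally: $\mathtt{root}\,(1,x)=x$; $\mathtt{root}\,\lambda((i,x),t)$ is the word formed by the last $i$ letters of $\mathtt{root}\,t$; $\mathtt{root}(u\oplus v)$ is the concatenation of $\mathtt{root}\,u$ and $\mathtt{root}\,v$. - If $t=\lambda((i_1,x_1),t_1)\oplus\dots\oplus\lambda((i_k,x_k),t_k)$ is the unique such decomposition (so all $x_j$ equal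 the name of the root of $t$), then $\mathtt{sub}\,t=(\mathtt{v}(t_1),\dots,\mathtt{v}(t_k))$, a tuple of words. - If $t=\gamma((i_1,x_1),t_1)\oslash\dots\oslash\gamma((i_k,x_k),t_k)$ (such a decomposition exists, and $t_1,\dots,t_k$ are uniquely determined), then $\mathtt{rsub}\,t=(\mathtt{v}(t_k)^r,\dots,\mathtt{v}(t_1)^r)$. *)

theory Defs
  imports Main
begin

text \<open>
  Rooted plane trees whose nodes carry an integer label and a name.  A tree is identified
  with its root node, so the nodes of a tree are represented by the subtrees rooted at them.
\<close>

datatype 'a tree = Node (label: nat) (name: 'a) (children: "'a tree list")

abbreviation single :: "'a \<Rightarrow> 'a tree" where
  "single x \<equiv> Node 1 x []"

definition has_edge :: "'a tree \<Rightarrow> bool" where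
  "has_edge t \<longleftrightarrow> children t \<noteq> []"

text \<open>The nodes in preorder.\<close>

primrec nodes :: "'a tree \<Rightarrow> 'a tree list" where
  "nodes (Node n x ts) = Node n x ts # concat (map nodes ts)"

definition preorder :: "'a tree \<Rightarrow> 'a list" where
  "preorder t = map name (nodes t)"

definition names :: "'a tree \<Rightarrow> 'a set" where
  "names t = set (preorder t)"

definition child_sum :: "'a tree \<Rightarrow> nat" where
  "child_sum t = sum_list (map label (children t))"

definition beta10 :: "'a tree \<Rightarrow> bool" where
  "beta10 t \<longleftrightarrow>
     (\<forall>s\<in>set (nodes t). 1 \<le> label s) \<and>
     (\<forall>s\<in>set (nodes t). children s = [] \<longrightarrow> label s = 1) \<and>
     (children t \<noteq> [] \<longrightarrow> label t = child_sum t) \<and>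
     (\<forall>c\<in>set (children t). \<forall>s\<in>set (nodes c). children s \<noteq> [] \<longrightarrow> label s \<le> child_sum s)"

definition labeled_tree :: "'a tree \<Rightarrow> bool" where
  "labeled_tree t \<longleftrightarrow> beta10 t \<and> distinct (preorder t)"

lemma size_last [termination_simp]:
  "ts \<noteq> [] \<Longrightarrow> size (last ts) < Suc (size_list size ts)"
  by (induction ts) auto

text \<open>The nodes on the right path, from the root to the rightmost leaf.\<close>

fun right_path :: "'a tree \<Rightarrow> 'a tree list" where
  "right_path (Node n x ts) =
     Node n x ts # (if ts = [] then [] else right_path (last ts))"

definition rpath_length :: "'a tree \<Rightarrow> nat" where
  "rpath_length t = length (right_path t) - 1"


text \<open>
  The operations are total functions; the side conditions under which they are meaningful
  are the separate predicates ending in \<open>_ok\<close>.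
\<close>

fun oplus :: "'a tree \<Rightarrow> 'a tree \<Rightarrow> 'a tree"  (infixr "\<oplus>" 65) where
  "Node m x ts \<oplus> Node n y us = Node (m + n) x (ts @ us)"

definition oplus_ok :: "'a tree \<Rightarrow> 'a tree \<Rightarrow> bool" where
  "oplus_ok u v \<longleftrightarrow> labeled_tree u \<and> labeled_tree v \<and> has_edge u \<and> has_edge v \<and>
     name u = name v \<and> names u \<inter> names v = {name u}"

fun lam :: "nat \<Rightarrow> 'a \<Rightarrow> 'a tree \<Rightarrow> 'a tree" where
  "lam i x (Node n y ts) = Node i x [Node i y ts]"

definition lam_ok :: "nat \<Rightarrow> 'a \<Rightarrow> 'a tree \<Rightarrow> bool" where
  "lam_ok i x t \<longleftrightarrow> labeled_tree t \<and> 1 \<le> i \<and> i \<le> label t \<and> x \<notin> names t"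

fun oslash :: "'a tree \<Rightarrow> 'a tree \<Rightarrow> 'a tree"  (infixr "\<oslash>" 65) where
  "Node n x ts \<oslash> v =
     (if ts = [] then Node 1 (name v) (children v)
      else Node n x (butlast ts @ [last ts \<oslash> v]))"

text \<open>
  The name of the rightmost leaf of \<open>u\<close> is discarded, so it is not required to be
  different from the names in \<open>v\<close>.
\<close>

definition oslash_ok :: "'a tree \<Rightarrow> 'a tree \<Rightarrow> bool" where
  "oslash_ok u v \<longleftrightarrow> labeled_tree u \<and> labeled_tree v \<and> has_edge u \<and> has_edge v \<and>
     (names u - {name (last (right_path u))}) \<inter> names v = {}"

text \<open>Attach a new last child at the \<open>i\<close>th node of the right path.\<close>

fun attach :: "nat \<Rightarrow> 'a \<Rightarrow> 'a tree \<Rightarrow> 'a tree" where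
  "attach i x (Node n y ts) =
     (if i \<le> 1 \<or> ts = [] then Node (n + 1) y (ts @ [single x])
      else Node (n + 1) y (butlast ts @ [attach (i - 1) x (last ts)]))"

definition gam :: "nat \<Rightarrow> 'a \<Rightarrow> 'a tree \<Rightarrow> 'a tree" where
  "gam i x t = (if has_edge t then attach i x t else Node 1 (name t) [single x])"

definition gam_ok :: "nat \<Rightarrow> 'a \<Rightarrow> 'a tree \<Rightarrow> bool" where
  "gam_ok i x t \<longleftrightarrow> labeled_tree t \<and> x \<notin> names t \<and> 1 \<le> i \<and>
     (if has_edge t then i \<le> rpath_length t else i = 1)"


text \<open>
  The unique decompositions: \<open>lam_decomp [t\<^sub>1, \<dots>, t\<^sub>k] t\<close> says that \<open>t\<close> is
  \<open>lam i\<^sub>1 x\<^sub>1 t\<^sub>1 \<oplus> \<dots> \<oplus> lam i\<^sub>k x\<^sub>k t\<^sub>k\<close> for some \<open>i\<^sub>j\<close> and \<open>x\<^sub>j\<close>, and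
  \<open>gam_decomp [t\<^sub>1, \<dots>, t\<^sub>k] t\<close> that it is
  \<open>gam i\<^sub>1 x\<^sub>1 t\<^sub>1 \<oslash> \<dots> \<oslash> gam i\<^sub>k x\<^sub>k t\<^sub>k\<close>.
\<close>

inductive lam_decomp :: "'a tree list \<Rightarrow> 'a tree \<Rightarrow> bool" where
  lam_single: "lam_ok i x s \<Longrightarrow> lam_decomp [s] (lam i x s)"
| lam_step: "lam_ok i x s \<Longrightarrow> lam_decomp ss v \<Longrightarrow> oplus_ok (lam i x s) v \<Longrightarrow>
    lam_decomp (s # ss) (lam i x s \<oplus> v)"

inductive gam_decomp :: "'a tree list \<Rightarrow> 'a tree \<Rightarrow> bool" where
  gam_single: "gam_ok i x s \<Longrightarrow> gam_decomp [s] (gam i x s)"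
| gam_step: "gam_ok i x s \<Longrightarrow> gam_decomp ss v \<Longrightarrow> oslash_ok (gam i x s) v \<Longrightarrow>
    gam_decomp (s # ss) (gam i x s \<oslash> v)"


text \<open>The word-valued statistics.\<close>

definition leaves_word :: "'a tree \<Rightarrow> 'a list" where
  "leaves_word t = map name (filter (\<lambda>s. children s = []) (nodes t))"

definition int_word :: "'a tree \<Rightarrow> 'a list" where
  "int_word t = map name (filter (\<lambda>s. children s \<noteq> []) (rev (nodes t)))"

definition rpath_word :: "'a tree \<Rightarrow> 'a list" where
  "rpath_word t = filter (\<lambda>a. a \<in> name ` set (butlast (right_path t))) (rev (preorder t))"

definition last_letters :: "nat \<Rightarrow> 'a list \<Rightarrow> 'a list" where
  "last_letters i w = drop (length w - i) w"

text \<open>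
  A tree with children \<open>c\<^sub>1, \<dots>, c\<^sub>k\<close> is the sum of the \<open>lam (label c\<^sub>j) x t\<^sub>j\<close>, where \<open>t\<^sub>j\<close> is \<open>c\<^sub>j\<close>
  up to the label of its root.  Neither \<open>root_word\<close> nor \<open>h_map\<close> below looks at the label of the
  root of its argument, so they may be applied to \<open>c\<^sub>j\<close> in place of \<open>t\<^sub>j\<close>; the lemmas following
  each definition are the defining recursions in terms of the operations.
\<close>

fun root_word :: "'a tree \<Rightarrow> 'a list" where
  "root_word (Node n x ts) =
     (if ts = [] then [x]
      else concat (map (\<lambda>c. last_letters (label c) (root_word c)) ts))"

lemma root_word_single: "root_word (single x) = [x]"
  by simp

lemma root_word_lam: "root_word (lam i x t) = last_letters i (root_word t)"
  by (cases t) simp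

lemma root_word_oplus:
  "has_edge u \<Longrightarrow> has_edge v \<Longrightarrow> root_word (u \<oplus> v) = root_word u @ root_word v"
  by (cases u; cases v) (simp add: has_edge_def)

definition sub_words :: "'a tree \<Rightarrow> 'a list list" where
  "sub_words t = map preorder (THE ts. lam_decomp ts t)"

definition rsub_words :: "'a tree \<Rightarrow> 'a list list" where
  "rsub_words t = map (\<lambda>s. rev (preorder s)) (rev (THE ts. gam_decomp ts t))"


fun oslash_list :: "'a tree list \<Rightarrow> 'a tree" where
  "oslash_list [] = undefined"
| "oslash_list [t] = t"
| "oslash_list (t # ts) = t \<oslash> oslash_list ts"

fun h_map :: "'a tree \<Rightarrow> 'a tree" where
  "h_map (Node n x ts) =
     (if ts = [] then single x
      else oslash_list (rev (map (\<lambda>c. gam (label c) x (h_map c)) ts)))"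

lemma h_map_single: "h_map (single x) = single x"
  by simp

lemma h_map_lam: "h_map (lam i x t) = gam i x (h_map t)"
  by (cases t) simp

lemma has_edge_gam: "has_edge (gam i x t)"
  by (cases t) (simp add: gam_def has_edge_def)

lemma has_edge_oslash: "has_edge u \<Longrightarrow> has_edge (u \<oslash> v)"
  by (cases u) (simp add: has_edge_def)

lemma oslash_assoc: "has_edge v \<Longrightarrow> (u \<oslash> v) \<oslash> w = u \<oslash> (v \<oslash> w)"
proof (induction u v rule: oslash.induct)
  case (1 n x ts v)
  then show ?case
    by (cases v) (simp add: has_edge_def)
qed

lemma has_edge_oslash_list:
  "ts \<noteq> [] \<Longrightarrow> \<forall>t\<in>set ts. has_edge t \<Longrightarrow> has_edge (oslash_list ts)"
  by (induction ts rule: oslash_list.induct) (simp_all add: has_edge_oslash)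

lemma oslash_list_append:
  "ts \<noteq> [] \<Longrightarrow> us \<noteq> [] \<Longrightarrow> \<forall>t\<in>set ts. has_edge t \<Longrightarrow>
   oslash_list (ts @ us) = oslash_list ts \<oslash> oslash_list us"
proof (induction ts rule: oslash_list.induct)
  case (2 t)
  then show ?case by (cases us) simp_all
next
  case (3 t t' ts)
  then show ?case
    using has_edge_oslash_list[of "t' # ts"] by (simp add: oslash_assoc)
qed simp

lemma h_map_oplus:
  assumes "has_edge u" "has_edge v" "name u = name v"
  shows "h_map (u \<oplus> v) = h_map v \<oslash> h_map u"
  using assms
  by (cases u; cases v) (simp add: has_edge_def oslash_list_append has_edge_gam[unfolded has_edge_def])

end

theory Submission
  imports Defs
begin

text \<open>
  Following the recursion of \<open>h_map\<close>, the preorder word of \<open>h t\<close> is the reverse of that of \<open>t\<close>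
  with leaves and internal nodes exchanged, and the right path of \<open>h t\<close> spells the reverse of the
  root word of \<open>t\<close>; the latter shows that the \<open>gam\<close>-operations occurring in \<open>h t\<close> are meaningful.
  Conversely \<open>h\<close> turns \<open>gam\<close> into \<open>lam\<close> and \<open>\<oslash>\<close> into \<open>\<oplus>\<close>, so it is an involution, each remaining
  identity is one already shown applied to \<open>h t\<close>, and uniqueness of the \<open>gam\<close>-decomposition
  is inherited from that of the \<open>lam\<close>-decomposition.
\<close>

text \<open>Splitting off the first branch at the root mirrors the forms \<open>single\<close>,
  \<open>lam\<close> and \<open>\<oplus>\<close> of the recursion for \<open>h_map\<close>. The root
  label \<open>n\<close> is kept when a branch is removed, so properties proved this way must not
  depend on it.\<close>

lemma tree_branch_induct [case_names leaf one more]: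
  assumes leaf: "\<And>n x. P (Node n x [])"
    and one: "\<And>n x c. P c \<Longrightarrow> P (Node n x [c])"
    and more: "\<And>n x c cs. P c \<Longrightarrow> P (Node n x cs) \<Longrightarrow> cs \<noteq> [] \<Longrightarrow> P (Node n x (c # cs))"
  shows "P t"
proof (induction t)
  case (Node n x ts)
  then show ?case
  proof (induction ts)
    case Nil
    show ?case by (rule leaf)
  next
    case (Cons c cs)
    then show ?case by (cases "cs = []") (auto intro: one more)
  qed
qed

lemma has_edge_Node [simp]: "has_edge (Node n x ts) \<longleftrightarrow> ts \<noteq> []"
  by (simp add: has_edge_def)

lemma preorder_Node [simp]: "preorder (Node n x ts) = x # concat (map preorder ts)"
  by (simp add: preorder_def[abs_def] map_concat comp_def)

lemma right_path_nonempty [simp]: "right_path t \<noteq> []"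
  by (cases t) simp

lemma name_last_right_path: "name (last (right_path t)) = last (preorder t)"
proof (induction t rule: right_path.induct)
  case (1 n x ts)
  show ?case
  proof (cases ts rule: rev_cases)
    case (snoc us c)
    moreover have "preorder c \<noteq> []" by (cases c) simp
    ultimately show ?thesis using 1 by simp
  qed simp
qed

subsection \<open>Admissible labels\<close>

text \<open>
  The label that a node must have as a root, and the largest one it may have elsewhere.
\<close>

definition max_label :: "'a tree \<Rightarrow> nat" where
  "max_label t = (if has_edge t then child_sum t else 1)"

text \<open>The root label is left unconstrained, so the condition survives passing to a child or
  dropping branches at the root, as the inductions require.\<close>

fun admissible :: "'a tree \<Rightarrow> bool" where
  "admissible (Node n x ts) \<longleftrightarrow>
     (\<forall>c\<in>set ts. admissible c \<and> 1 \<le> label c \<and> label c \<le> max_label c)"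

lemma max_label_Node [simp]:
  "max_label (Node n x ts) = (if ts = [] then 1 else sum_list (map label ts))"
  by (simp add: max_label_def child_sum_def)

lemma ball_nodes:
  "(\<forall>s\<in>set (nodes t). Q s) \<longleftrightarrow> Q t \<and> (\<forall>c\<in>set (children t). \<forall>s\<in>set (nodes c). Q s)"
  by (cases t) auto

lemma admissible_iff:
  "admissible t \<longleftrightarrow>
     (\<forall>c\<in>set (children t). \<forall>s\<in>set (nodes c). 1 \<le> label s \<and> label s \<le> max_label s)"
proof (induction t)
  case (Node n x ts)
  let ?Q = "\<lambda>s :: 'a tree. 1 \<le> label s \<and> label s \<le> max_label s"
  have "(\<forall>s\<in>set (nodes c). ?Q s) \<longleftrightarrow> admissible c \<and> ?Q c" if "c \<in> set ts" for c
    using Node.IH[OF that] ball_nodes[of c ?Q] by argo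
  then show ?case by simp
qed

lemma max_label_pos: "admissible t \<Longrightarrow> 1 \<le> max_label t"
  by (cases t; cases "children t") auto

text \<open>The conditions on leaves and on inner non-root nodes merge into
  \<open>1 \<le> label s \<le> max_label s\<close>, since \<open>max_label\<close> is 1 on leaves.
  Positivity of the root label comes from \<open>max_label_pos\<close>.\<close>

lemma beta10_iff: "beta10 t \<longleftrightarrow> admissible t \<and> label t = max_label t"
proof -
  let ?P = "\<lambda>s :: 'a tree. 1 \<le> label s"
  let ?L = "\<lambda>s :: 'a tree. children s = [] \<longrightarrow> label s = 1"
  let ?I = "\<lambda>s :: 'a tree. children s \<noteq> [] \<longrightarrow> label s \<le> child_sum s"
  have PLI: "1 \<le> label s \<and> label s \<le> max_label s \<longleftrightarrow> ?P s \<and> ?L s \<and> ?I s" for s :: "'a tree"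
    by (auto simp: max_label_def has_edge_def)
  have "admissible t \<longleftrightarrow> (\<forall>c\<in>set (children t). (\<forall>s\<in>set (nodes c). ?P s) \<and>
      (\<forall>s\<in>set (nodes c). ?L s) \<and> (\<forall>s\<in>set (nodes c). ?I s))"
    unfolding admissible_iff PLI by blast
  moreover have "label t = max_label t \<longleftrightarrow> ?L t \<and> (children t \<noteq> [] \<longrightarrow> label t = child_sum t)"
    by (simp add: max_label_def has_edge_def)
  moreover have "?P t" if "admissible t" "label t = max_label t"
    using max_label_pos that by metis
  ultimately show ?thesis
    unfolding beta10_def ball_nodes[of t ?P] ball_nodes[of t ?L] by blast
qed

lemma labeled_admissible: "labeled_tree t \<Longrightarrow> admissible t"
  by (simp add: labeled_tree_def beta10_iff)

lemma label_labeled: "labeled_tree t \<Longrightarrow> label t = max_label t"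
  by (simp add: labeled_tree_def beta10_iff)

text \<open>Repairs the root label. If \<open>c\<close> is a child of the root, then
  \<open>relabel c\<close> is the corresponding component of the
  \<open>lam\<close>-decomposition.\<close>

definition relabel :: "'a tree \<Rightarrow> 'a tree" where
  "relabel t = Node (max_label t) (name t) (children t)"

lemma relabel_Node [simp]: "relabel (Node n x ts) = Node (max_label (Node n x ts)) x ts"
  by (simp add: relabel_def)

lemma label_relabel [simp]: "label (relabel t) = max_label t"
  by (simp add: relabel_def)

lemma preorder_relabel [simp]: "preorder (relabel t) = preorder t"
  by (cases t) simp

lemma relabel_beta10: "beta10 t \<Longrightarrow> relabel t = t"
  by (cases t) (simp add: beta10_iff relabel_def)

lemma beta10_relabel: "admissible t \<Longrightarrow> beta10 (relabel t)"
  by (cases t) (simp add: beta10_iff)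

lemma h_map_relabel: "h_map (relabel t) = h_map t"
  by (cases t) simp

section \<open>The right path as a word\<close>

definition spine :: "'a tree \<Rightarrow> 'a list" where
  "spine t = map name (butlast (right_path t))"

lemma spine_Node [simp]: "spine (Node n x ts) = (if ts = [] then [] else x # spine (last ts))"
  by (simp add: spine_def)

lemma rpath_length_spine: "rpath_length t = length (spine t)"
  by (simp add: rpath_length_def spine_def)

lemma set_spine: "set (spine t) \<subseteq> set (preorder t)"
proof (induction t)
  case (Node n x ts)
  then show ?case by (cases ts rule: rev_cases) auto
qed

lemma filter_spine:
  "distinct (preorder t) \<Longrightarrow> filter (\<lambda>a. a \<in> set (spine t)) (preorder t) = spine t"
proof (induction t rule: right_path.induct)
  case (1 n x ts)
  show ?case
  proof (cases ts rule: rev_cases)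
    case (snoc us c)
    let ?pre = "concat (map preorder us)"
    have d: "x \<notin> set ?pre" "x \<notin> set (preorder c)" "set ?pre \<inter> set (preorder c) = {}"
        "distinct (preorder c)"
      using 1(2) snoc by auto
    \<comment> \<open>Names are distinct, so the branches before the last one contain no name of the
      right path.\<close>
    have "filter (\<lambda>a. a \<in> insert x (set (spine c))) ?pre = []"
      using d set_spine[of c] by (fastforce simp: filter_empty_conv)
    moreover have "filter (\<lambda>a. a \<in> insert x (set (spine c))) (preorder c)
        = filter (\<lambda>a. a \<in> set (spine c)) (preorder c)"
      using d by (intro filter_cong) auto
    ultimately show ?thesis using 1(1) d snoc by simp
  qed simp
qed

lemma rpath_word_eq:
  assumes "distinct (preorder t)"
  shows "rpath_word t = rev (spine t)"
proof -
  have "name ` set (butlast (right_path t)) = set (spine t)"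
    by (simp add: spine_def)
  then show ?thesis
    using filter_spine[OF assms] by (simp add: rpath_word_def rev_filter[symmetric])
qed

definition gam_fits :: "nat \<Rightarrow> 'a tree \<Rightarrow> bool" where
  "gam_fits i t \<longleftrightarrow> 1 \<le> i \<and> (if has_edge t then i \<le> length (spine t) else i = 1)"

lemma gam_ok_iff:
  "gam_ok i x t \<longleftrightarrow> labeled_tree t \<and> x \<notin> names t \<and> gam_fits i t"
  by (auto simp: gam_ok_def gam_fits_def rpath_length_spine)

subsection \<open>Statistics of the composed trees\<close>

text \<open>Keeping a leaf flag with each name lets \<open>preorder\<close>,
  \<open>leaves_word\<close> and \<open>int_word\<close> all be read off one word.\<close>

definition marked :: "'a tree \<Rightarrow> ('a \<times> bool) list" where
  "marked t = map (\<lambda>s. (name s, children s = [])) (nodes t)"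

lemma marked_Node [simp]: "marked (Node n x ts) = (x, ts = []) # concat (map marked ts)"
  by (simp add: marked_def[abs_def] map_concat comp_def)

lemma preorder_marked: "preorder t = map fst (marked t)"
  by (simp add: preorder_def marked_def)

lemma leaves_word_marked: "leaves_word t = map fst (filter snd (marked t))"
  by (simp add: leaves_word_def marked_def filter_map comp_def)

lemma int_word_marked: "int_word t = rev (map fst (filter (Not \<circ> snd) (marked t)))"
  by (simp add: int_word_def marked_def filter_map comp_def rev_map rev_filter)

section \<open>Attaching a leaf to the right path\<close>

lemma attach_eq:
  "attach i x (Node n y (us @ [c])) =
     Node (n + 1) y (if i \<le> 1 then us @ [c, single x] else us @ [attach (i - 1) x c])"
  by simp

lemma label_attach [simp]: "label (attach i x t) = label t + 1"
  by (cases t) simp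

declare attach.simps [simp del]

text \<open>Descends the right path. An index above 1 forces the last child to be an inner node,
  because its spine is then nonempty.\<close>

lemma attach_induct [consumes 2, case_names root deeper]:
  assumes "1 \<le> i" "i \<le> length (spine t)"
    and root: "\<And>n y ts. ts \<noteq> [] \<Longrightarrow> P 1 (Node n y ts)"
    and deeper: "\<And>i n y us c. 1 \<le> i \<Longrightarrow> i \<le> length (spine c) \<Longrightarrow> has_edge c \<Longrightarrow> P i c
       \<Longrightarrow> P (Suc i) (Node n y (us @ [c]))"
  shows "P i t"
  using assms(1,2)
proof (induction t arbitrary: i)
  case (Node n y ts)
  show ?case
  proof (cases ts rule: rev_cases)
    case Nil
    then show ?thesis using Node.prems by simp
  next
    case (snoc us c)
    show ?thesis
    proof (cases "i = 1")
      case True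
      then show ?thesis using root snoc by simp
    next
      case False
      then obtain j where j: "i = Suc j" "1 \<le> j"
        using Node.prems by (cases i) auto
      moreover have "j \<le> length (spine c)" using Node.prems j snoc by simp
      moreover from this have "has_edge c" using j by (cases c) (auto split: if_splits)
      ultimately show ?thesis using deeper Node.IH[of c j] snoc by simp
    qed
  qed
qed

lemma attach_1 [simp]: "attach (Suc 0) x (Node n y ts) = Node (n + 1) y (ts @ [single x])"
  by (simp add: attach.simps)

lemma attach_Suc [simp]:
  "1 \<le> i \<Longrightarrow> attach (Suc i) x (Node n y (us @ [c])) = Node (n + 1) y (us @ [attach i x c])"
  by (simp add: attach_eq)

text \<open>The new leaf is the last child of a node on the right path, hence last in preorder. That
  node was already internal, so no old flag changes.\<close>

lemma marked_attach:
  assumes "1 \<le> i" "i \<le> length (spine t)"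
  shows "marked (attach i x t) = marked t @ [(x, True)]"
  using assms by (induction rule: attach_induct) simp_all

text \<open>The right path now turns into the new leaf after its \<open>i\<close>th node.\<close>

lemma spine_attach:
  assumes "1 \<le> i" "i \<le> length (spine t)"
  shows "spine (attach i x t) = take i (spine t)"
  using assms by (induction rule: attach_induct) simp_all

lemma max_label_attach:
  assumes "1 \<le> i" "i \<le> length (spine t)"
  shows "max_label (attach i x t) = max_label t + 1"
  using assms by (induction rule: attach_induct) simp_all

lemma admissible_attach:
  assumes "1 \<le> i" "i \<le> length (spine t)" "admissible t"
  shows "admissible (attach i x t)"
  using assms by (induction rule: attach_induct) (auto simp: max_label_attach)

lemma marked_gam:
  "gam_fits i t \<Longrightarrow>
     marked (gam i x t) = (if has_edge t then marked t else [(name t, False)]) @ [(x, True)]"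
  by (auto simp: gam_fits_def gam_def marked_attach)

lemma spine_gam:
  "gam_fits i t \<Longrightarrow> spine (gam i x t) = (if has_edge t then take i (spine t) else [name t])"
  by (auto simp: gam_fits_def gam_def spine_attach)

lemma beta10_gam: "gam_fits i t \<Longrightarrow> beta10 t \<Longrightarrow> beta10 (gam i x t)"
  by (auto simp: gam_fits_def gam_def beta10_iff admissible_attach max_label_attach)

declare has_edge_gam [simp]

section \<open>Grafting at the rightmost leaf\<close>

declare oslash.simps [simp del]

lemma oslash_leaf [simp]:
  "Node n x [] \<oslash> v = Node 1 (name v) (children v)"
  by (simp add: oslash.simps)

lemma oslash_inner [simp]:
  "Node n x (us @ [c]) \<oslash> v = Node n x (us @ [c \<oslash> v])"
  by (simp add: oslash.simps)

lemma oslash_induct [consumes 1, case_names leaf deeper]: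
  assumes "has_edge u"
    and leaf: "\<And>n x us m y. P (Node n x (us @ [Node m y []]))"
    and deeper: "\<And>n x us c. has_edge c \<Longrightarrow> P c \<Longrightarrow> P (Node n x (us @ [c]))"
  shows "P u"
  using assms(1)
proof (induction u)
  case (Node n x ts)
  then obtain us c where "ts = us @ [c]" by (cases ts rule: rev_cases) auto
  then show ?case using Node.IH leaf deeper by (cases c; cases "has_edge c") auto
qed

lemma label_oslash: "has_edge u \<Longrightarrow> label (u \<oslash> v) = label u"
  by (cases u) (simp add: oslash.simps)

lemma max_label_oslash:
  assumes "has_edge u" "admissible u"
  shows "max_label (u \<oslash> v) = max_label u"
  using assms by (induction rule: oslash_induct) (auto simp: label_oslash)

lemma marked_ne [simp]: "marked t \<noteq> []"
  by (cases t) simp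

lemma marked_top: "has_edge v \<Longrightarrow> marked (Node k (name v) (children v)) = marked v"
  by (cases v) simp

lemma spine_top: "spine (Node k (name v) (children v)) = spine v"
  by (cases v) simp

lemma marked_oslash:
  assumes "has_edge u" "has_edge v"
  shows "marked (u \<oslash> v) = butlast (marked u) @ marked v"
  using assms
proof (induction rule: oslash_induct)
  case (leaf n x us m y)
  then show ?case using marked_top[of v 1] by (simp add: butlast_append)
qed (auto simp: butlast_append)

lemma preorder_oslash:
  assumes "has_edge u" "has_edge v"
  shows "preorder (u \<oslash> v) = butlast (preorder u) @ preorder v"
  using assms by (simp add: preorder_marked marked_oslash map_butlast)

lemma spine_oslash:
  assumes "has_edge u"
  shows "spine (u \<oslash> v) = spine u @ spine v"
  using assms
proof (induction rule: oslash_induct)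
  case (leaf n x us m y)
  then show ?case using spine_top[of 1 v] by simp
qed auto

lemma admissible_oslash:
  assumes "has_edge u" "admissible u" "beta10 v"
  shows "admissible (u \<oslash> v)"
  using assms
proof (induction rule: oslash_induct)
  case (leaf n x us m y)
  \<comment> \<open>The replaced leaf and the identified node both have label 1, so no child sum
    changes, and 1 is an allowed label by \<open>max_label_pos\<close>.\<close>
  then show ?case using max_label_pos[of v] by (cases v) (auto simp: beta10_iff)
next
  case (deeper n x us c)
  then show ?case by (auto simp: label_oslash max_label_oslash)
qed

lemma beta10_oslash:
  "has_edge u \<Longrightarrow> beta10 u \<Longrightarrow> beta10 v \<Longrightarrow> beta10 (u \<oslash> v)"
  by (simp add: beta10_iff admissible_oslash label_oslash max_label_oslash)

subsection \<open>The map h\<close>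

declare h_map.simps [simp del]

lemma h_leaf [simp]: "h_map (Node n x []) = single x"
  by (simp add: h_map.simps)

lemma h_one [simp]: "h_map (Node n x [c]) = gam (label c) x (h_map c)"
  by (simp add: h_map.simps)

lemma h_append:
  "us \<noteq> [] \<Longrightarrow> vs \<noteq> [] \<Longrightarrow> h_map (Node n x (us @ vs)) = h_map (Node m x vs) \<oslash> h_map (Node k x us)"
  by (simp add: h_map.simps oslash_list_append)

lemma h_Cons [simp]:
  "cs \<noteq> [] \<Longrightarrow> h_map (Node n x (c # cs)) = h_map (Node n x cs) \<oslash> gam (label c) x (h_map c)"
  using h_append[of "[c]" cs n x n n] by simp

lemma has_edge_h [simp]: "has_edge (h_map t) = has_edge t"
  by (induction t rule: tree_branch_induct) (auto simp: has_edge_oslash)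

text \<open>Each child \<open>c\<close> supplies exactly \<open>label c\<close> letters: by
  induction its root word has length \<open>max_label c\<close>, which is large enough.\<close>

lemma length_root_word: "admissible t \<Longrightarrow> length (root_word t) = max_label t"
proof (induction t)
  case (Node n x ts)
  then have eq: "map (\<lambda>c. length (last_letters (label c) (root_word c))) ts = map label ts"
    by (auto simp: last_letters_def)
  show ?case by (simp add: length_concat comp_def eq del: map_eq_conv)
qed

text \<open>Both claims are proved together: \<open>gam (label c) x (h_map c)\<close> is meaningful
  only if \<open>label c\<close> is at most the length of the spine of \<open>h_map c\<close>, and
  that length is known from the root word of \<open>c\<close>.\<close>

lemma root_word_h_beta10:
  "admissible t \<Longrightarrow> beta10 (h_map t) \<and> (has_edge t \<longrightarrow> root_word t = rev (spine (h_map t)))"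
proof -
  have fits: "gam_fits (label c) (h_map c)"
    if "admissible c" "1 \<le> label c" "label c \<le> max_label c"
      "has_edge c \<longrightarrow> root_word c = rev (spine (h_map c))" for c :: "'a tree"
    using that length_root_word[of c] by (auto simp: gam_fits_def max_label_def)
  \<comment> \<open>\<open>gam\<close> truncates the spine to its first \<open>label c\<close>
    names, which after reversal are the last letters of the root word.\<close>
  have gam: "last_letters (label c) (root_word c) = rev (spine (gam (label c) x (h_map c)))"
    if "admissible c" "1 \<le> label c" "label c \<le> max_label c"
      "has_edge c \<longrightarrow> root_word c = rev (spine (h_map c))" for x and c :: "'a tree"
    using that spine_gam[OF fits, of c x]
    by (cases c) (auto simp: last_letters_def rev_take split: if_splits)
  show "admissible t \<Longrightarrow> ?thesis"
  proof (induction t rule: tree_branch_induct)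
    case (leaf n x)
    then show ?case by (simp add: beta10_iff)
  next
    case (one n x c)
    then show ?case using fits gam by (simp add: beta10_gam)
  next
    case (more n x c cs)
    then show ?case using fits gam by (simp add: beta10_gam beta10_oslash spine_oslash)
  qed
qed

lemma gam_fits_h:
  assumes "admissible t" "1 \<le> i" "i \<le> max_label t"
  shows "gam_fits i (h_map t)"
proof (cases "has_edge t")
  case True
  then have "length (spine (h_map t)) = max_label t"
    using assms root_word_h_beta10[of t] length_root_word[of t] by simp
  then show ?thesis using assms True by (simp add: gam_fits_def)
next
  case False
  then show ?thesis using assms by (simp add: gam_fits_def max_label_def)
qed

lemma marked_h:
  assumes "admissible t" "has_edge t"
  shows "marked (h_map t) = rev (map (map_prod id Not) (marked t))"
  using assms
proof (induction t rule: tree_branch_induct)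
  case (one n x c)
  then show ?case
    by (cases c) (auto simp: marked_gam gam_fits_h)
next
  case (more n x c cs)
  \<comment> \<open>This also covers a leaf \<open>c\<close>, where \<open>h_map c\<close> is still
    a leaf but \<open>gam\<close> makes its node internal. Grafting then drops the final
    \<open>(x, True)\<close> of the left factor, so the root name \<open>x\<close> occurs only
    once.\<close>
  have "marked (gam (label c) x (h_map c)) = rev (map (map_prod id Not) (marked c)) @ [(x, True)]"
    using more by (cases c) (auto simp: marked_gam gam_fits_h)
  then show ?case using more by (simp add: marked_oslash id_def)
qed simp

lemma preorder_h:
  assumes "admissible t"
  shows "preorder (h_map t) = rev (preorder t)"
proof (cases "has_edge t")
  case True
  then show ?thesis using assms by (simp add: preorder_marked marked_h rev_map)
next
  case False
  then show ?thesis by (cases t) simp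
qed

lemma names_h: "admissible t \<Longrightarrow> names (h_map t) = names t"
  by (simp add: names_def preorder_h)

lemma labeled_h: "labeled_tree t \<Longrightarrow> labeled_tree (h_map t)"
  by (auto simp: labeled_tree_def beta10_iff preorder_h root_word_h_beta10[unfolded beta10_iff])

subsection \<open>The map h is an involution\<close>

lemma has_edge_lam [simp]: "has_edge (lam i x t)"
  by (cases t) simp

text \<open>This and the next three lemmas are commutation rules: \<open>lam\<close> and
  \<open>\<oplus>\<close> build at the root, whereas \<open>\<oslash>\<close> and \<open>gam\<close>
  act on the right path, which lies in the last branch.\<close>

lemma lam_oslash: "has_edge t \<Longrightarrow> lam i x t \<oslash> v = lam i x (t \<oslash> v)"
  by (cases t) (use oslash_inner[of i x "[]"] in \<open>simp add: oslash.simps\<close>)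

lemma oplus_oslash: "has_edge v \<Longrightarrow> (u \<oplus> v) \<oslash> w = u \<oplus> (v \<oslash> w)"
  by (cases u; cases v) (simp add: oslash.simps butlast_append)

lemma gam_oplus: "has_edge v \<Longrightarrow> gam i x (u \<oplus> v) = u \<oplus> gam i x v"
  by (cases u; cases v) (simp add: gam_def attach.simps butlast_append)

lemma gam_lam:
  assumes "has_edge t" "1 \<le> j"
  shows "gam (Suc j) x (lam i y t) = lam (Suc i) y (gam j x t)"
proof (cases t)
  case (Node n z us)
  then show ?thesis using assms attach_Suc[of j x i y "[]"]
    by (cases "attach j x (Node i z us)") (auto simp: gam_def attach.simps)
qed

lemma h_attach:
  assumes "1 \<le> i" "i \<le> length (spine t)" "admissible t"
  shows "h_map (attach i x t) = lam i x (h_map t)"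
  using assms
proof (induction rule: attach_induct)
  case (root n y ts)
  \<comment> \<open>The new leaf is the last branch, so its image is the first
    \<open>\<oslash>\<close>-factor. That factor is a two-node tree with root \<open>x\<close>, and
    grafting onto its leaf puts \<open>x\<close> above the other factor.\<close>
  have "gam 1 y (single x) = lam 1 x (single y)" by (simp add: gam_def)
  moreover have "lam 1 x (single y) \<oslash> v = lam 1 x v" for v
    using oslash_inner[of 1 x "[]"] by (cases v) simp
  ultimately show ?case
    using root h_append[of ts "[single x]" "n + 1" y 1 n] by simp
next
  case (deeper i n y us c)
  then have c: "h_map (attach i x c) = lam i x (h_map c)" "1 \<le> label c" by auto
  \<comment> \<open>Attaching below \<open>c\<close> has raised its label by 1. This is the shift
    needed to move \<open>gam\<close> past \<open>lam\<close> by \<open>gam_lam\<close>.\<close>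
  have last: "gam (label c + 1) y (h_map (attach i x c)) = lam (Suc i) x (gam (label c) y (h_map c))"
    using c gam_lam[of "h_map c" "label c"] \<open>has_edge c\<close> by simp
  show ?case
  proof (cases "us = []")
    case True
    then show ?thesis using last attach_Suc[of i x n y "[]" c] \<open>1 \<le> i\<close> by simp
  next
    case False
    then show ?thesis
      using last deeper.hyps h_append[of us "[attach i x c]" "n + 1" y n n] h_append[of us "[c]" n y n n]
      by (simp add: lam_oslash)
  qed
qed

lemma h_gam:
  assumes "gam_fits i t" "admissible t"
  shows "h_map (gam i x t) = lam i x (h_map t)"
proof (cases "has_edge t")
  case True
  then show ?thesis using assms by (simp add: gam_fits_def gam_def h_attach)
next
  case False
  then show ?thesis using assms by (cases t) (simp add: gam_fits_def gam_def)
qed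

lemma h_oslash:
  assumes "has_edge u" "has_edge v"
  shows "h_map (u \<oslash> v) = h_map v \<oplus> h_map u"
  using assms
proof (induction rule: oslash_induct)
  case (leaf n x us m y)
  have v: "h_map (Node 1 (name v) (children v)) = h_map v" by (cases v) (simp add: h_map.simps)
  \<comment> \<open>Attaching \<open>x\<close> at the root adds a one-edge branch. The name
    \<open>y\<close> disappears, as \<open>\<oplus>\<close> keeps the name of its left argument, and
    \<open>m\<close> is irrelevant because \<open>gam\<close> ignores its index on a single
    node.\<close>
  have "gam 1 x (h_map v) = h_map v \<oplus> gam m x (single y)"
    using has_edge_h[of v] leaf by (cases "h_map v") (auto simp: gam_def attach.simps)
  then show ?case
    using v h_append[of us "[Node 1 (name v) (children v)]" n x n n]
      h_append[of us "[Node m y []]" n x n n]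
    by (cases "us = []") (auto simp: oplus_oslash oslash_inner[of n x "[]", simplified])
next
  case (deeper n x us c)
  have last: "gam (label c) x (h_map (c \<oslash> v)) = h_map v \<oplus> gam (label c) x (h_map c)"
    using deeper by (simp add: gam_oplus)
  show ?case
  proof (cases "us = []")
    case True
    then show ?thesis using last deeper oslash_inner[of n x "[]" c v] by (simp add: label_oslash)
  next
    case False
    then show ?thesis
      using last deeper h_append[of us "[c \<oslash> v]" n x n n] h_append[of us "[c]" n x n n]
      by (simp add: label_oslash oplus_oslash)
  qed
qed

text \<open>By \<open>h_gam\<close> and \<open>h_oslash\<close> the second application undoes the
  first branch by branch. Only the root label, which \<open>h_map\<close> ignores, has to be
  recomputed.\<close>

lemma h_h:
  assumes "admissible t"
  shows "h_map (h_map t) = relabel t"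
  using assms
proof (induction t rule: tree_branch_induct)
  case (one n x c)
  then show ?case
    by (cases c) (auto simp: h_gam gam_fits_h root_word_h_beta10[unfolded beta10_iff])
next
  case (more n x c cs)
  have "h_map (gam (label c) x (h_map c)) = Node (label c) x [c]"
    using more by (cases c) (auto simp: h_gam gam_fits_h root_word_h_beta10[unfolded beta10_iff])
  then show ?case using more by (simp add: h_oslash)
qed simp

lemma h_h_beta10: "beta10 t \<Longrightarrow> h_map (h_map t) = t"
  by (simp add: h_h relabel_beta10 beta10_iff)

subsection \<open>The decompositions\<close>

lemma children_lam: "map relabel (children (lam i x t)) = [relabel t]"
  by (cases t) simp

lemma children_oplus [simp]: "children (u \<oplus> v) = children u @ children v"
  by (cases u; cases v) simp

text \<open>Each summand contributes one branch at the root. \<open>lam\<close> overwrites the root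
  label of its argument, but that label is forced by \<open>beta10\<close>, so
  \<open>relabel\<close> recovers it.\<close>

lemma lam_decomp_unique: "lam_decomp ss t \<Longrightarrow> ss = map relabel (children t)"
  by (induction rule: lam_decomp.induct)
    (auto simp: children_lam[simplified] lam_ok_def labeled_tree_def relabel_beta10)

lemma lam_decomp_children:
  assumes "admissible t" "distinct (preorder t)" "has_edge t"
  shows "lam_decomp (map relabel (children t)) (relabel t)"
proof -
  have lam: "lam (label c) x (relabel c) = Node (label c) x [c]" for x and c :: "'a tree"
    by (cases c) simp
  have ok: "lam_ok (label c) x (relabel c)"
    if "admissible (Node n x (c # cs))" "distinct (preorder (Node n x (c # cs)))"
    for n x and c :: "'a tree" and cs
    using that by (auto simp: lam_ok_def labeled_tree_def beta10_relabel names_def)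
  show ?thesis
    using assms
  proof (induction t rule: tree_branch_induct)
    case (one n x c)
    then show ?case
      using lam_decomp.lam_single[OF ok[OF one.prems(1,2)]] by (simp add: lam)
  next
    case (more n x c cs)
    have "oplus_ok (lam (label c) x (relabel c)) (relabel (Node n x cs))"
      using more.prems more.hyps
      by (auto simp: lam oplus_ok_def labeled_tree_def beta10_iff names_def)
    then show ?case
      using more lam_decomp.lam_step[OF ok[OF more.prems(1,2)], of _ "relabel (Node n x cs)"]
      by (simp add: lam)
  qed simp
qed

lemma sub_words_eq:
  assumes "labeled_tree t" "has_edge t"
  shows "sub_words t = map preorder (children t)"
proof -
  have "lam_decomp (map relabel (children t)) t"
    using assms lam_decomp_children[of t]
    by (simp add: labeled_tree_def relabel_beta10) (simp add: beta10_iff)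
  then have "(THE ss. lam_decomp ss t) = map relabel (children t)"
    using lam_decomp_unique by blast
  then show ?thesis by (simp add: sub_words_def)
qed

section \<open>Existence and uniqueness of the \<open>gam\<close>-decomposition\<close>

lemma oslash_ok_iff:
  "oslash_ok u v \<longleftrightarrow> labeled_tree u \<and> labeled_tree v \<and> has_edge u \<and> has_edge v \<and>
     set (butlast (preorder u)) \<inter> set (preorder v) = {}"
proof -
  have "names u - {name (last (right_path u))} = set (butlast (preorder u))" if "labeled_tree u"
  proof -
    obtain w a where "preorder u = w @ [a]" by (cases u; cases "preorder u" rule: rev_cases) auto
    then show ?thesis
      using that by (auto simp: names_def name_last_right_path labeled_tree_def)
  qed
  then show ?thesis unfolding oslash_ok_def names_def[of v] by blast
qed

lemma labeled_oslash: "oslash_ok u v \<Longrightarrow> labeled_tree (u \<oslash> v)"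
  by (auto simp: oslash_ok_iff labeled_tree_def beta10_oslash preorder_oslash distinct_butlast)

lemma has_edge_gam_decomp: "gam_decomp ss t \<Longrightarrow> has_edge t"
  by (induction rule: gam_decomp.induct) (auto simp: has_edge_oslash)

text \<open>\<open>gam_decomp\<close> grows on the left, but \<open>h_map\<close> reverses the order
  of the factors, so a step of \<open>lam_decomp\<close> adds a factor on the right.\<close>

lemma gam_decomp_snoc:
  assumes "gam_decomp ss u" "gam_ok i x s" "oslash_ok u (gam i x s)"
  shows "gam_decomp (ss @ [s]) (u \<oslash> gam i x s)"
  using assms
proof (induction rule: gam_decomp.induct)
  case (gam_single j y r)
  then show ?case
    using gam_decomp.gam_step[OF _ gam_decomp.gam_single, of j y r i x s] by simp
next
  case (gam_step j y r ss v)
  let ?r = "gam j y r" and ?s = "gam i x s"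
  have v: "has_edge v" "preorder v \<noteq> []"
    using gam_step.hyps has_edge_gam_decomp by auto (cases v; simp)
  have "oslash_ok v ?s"
    using gam_step.hyps gam_step.prems v
    by (auto simp: oslash_ok_iff preorder_oslash butlast_append)
  moreover from this have "oslash_ok ?r (v \<oslash> ?s)"
    using gam_step.hyps gam_step.prems v labeled_oslash[of v ?s]
    by (auto simp: oslash_ok_iff preorder_oslash butlast_append has_edge_oslash dest: in_set_butlastD)
  ultimately show ?case
    using gam_step v gam_decomp.gam_step[of j y r "ss @ [s]" "v \<oslash> ?s"] by (simp add: oslash_assoc)
qed

lemma gam_decomp_h:
  assumes "lam_decomp ss t"
  shows "gam_decomp (rev (map h_map ss)) (h_map t)"
proof -
  have ok: "gam_ok i x (h_map s)" if "lam_ok i x s" for i x and s :: "'a tree"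
    using that labeled_h[of s] gam_fits_h[of s i]
    by (auto simp: lam_ok_def gam_ok_iff names_h labeled_admissible label_labeled)
  show ?thesis
    using assms
  proof (induction rule: lam_decomp.induct)
    case (lam_single i x s)
    then show ?case using gam_decomp.gam_single[OF ok] by (simp add: h_map_lam)
  next
    case (lam_step i x s ss v)
    let ?u = "lam i x s"
    have u: "h_map ?u = gam i x (h_map s)" by (rule h_map_lam)
    have lab: "labeled_tree ?u" "labeled_tree v" "has_edge v" "name ?u = name v"
      and int: "names ?u \<inter> names v = {name ?u}"
      using lam_step.hyps by (auto simp: oplus_ok_def)
    have adm: "admissible ?u" "admissible v"
      using lab by (auto simp: labeled_tree_def beta10_iff)
    \<comment> \<open>The only name common to \<open>?u\<close> and \<open>v\<close> is that of the
      root. It comes last in the preorder of \<open>h_map v\<close>, so it is the name that grafting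
      discards.\<close>
    obtain w where w: "preorder v = name v # w" "name v \<notin> set w"
      using lab by (cases v) (simp add: labeled_tree_def)
    have "set w \<inter> names ?u \<subseteq> names ?u \<inter> names v"
      using w(1) by (auto simp: names_def[of v])
    also have "\<dots> = {name v}"
      using int lab by simp
    finally have "set w \<inter> names ?u = {}"
      using w(2) by blast
    moreover have "butlast (preorder (h_map v)) = rev w"
      using adm w by (simp add: preorder_h)
    ultimately have "set (butlast (preorder (h_map v))) \<inter> names ?u = {}"
      by simp
    then have "oslash_ok (h_map v) (h_map ?u)"
      using lab adm by (auto simp: oslash_ok_iff labeled_h preorder_h names_def)
    then show ?case
      using lab gam_decomp_snoc[OF lam_step.IH ok[OF lam_step.hyps(1)]]
      by (simp add: h_map_oplus u)
  qed
qed

text \<open>Applying \<open>h_map\<close> to the whole decomposition yields a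
  \<open>\<oplus>\<close>-sum of \<open>lam\<close>-trees in reverse order, whose components are
  determined by the branches of \<open>h_map t\<close>.\<close>

lemma gam_decomp_unique:
  "gam_decomp ss t \<Longrightarrow> map h_map ss = rev (map relabel (children (h_map t)))"
proof (induction rule: gam_decomp.induct)
  case (gam_single i x s)
  then show ?case
    by (auto simp: gam_ok_iff labeled_admissible h_gam children_lam[simplified]
        relabel_beta10 root_word_h_beta10)
next
  case (gam_step i x s ss v)
  then show ?case
    by (auto simp: gam_ok_iff labeled_admissible h_gam children_lam[simplified]
        relabel_beta10 root_word_h_beta10 h_oslash rev_map has_edge_gam_decomp)
qed

lemma labeled_gam_decomp: "gam_decomp ss t \<Longrightarrow> \<forall>s\<in>set ss. labeled_tree s"
  by (induction rule: gam_decomp.induct) (auto simp: gam_ok_def)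

lemma rsub_words_h:
  assumes "labeled_tree t" "has_edge t"
  shows "rsub_words (h_map t) = sub_words t"
proof -
  let ?ss = "rev (map h_map (map relabel (children t)))"
  have beta10: "beta10 t" and adm: "\<forall>c\<in>set (children t). admissible c"
    using assms by (cases t; auto simp: labeled_tree_def beta10_iff)+
  have ex: "gam_decomp ?ss (h_map t)"
    using assms lam_decomp_children[of t] beta10
    by (intro gam_decomp_h) (simp add: labeled_tree_def relabel_beta10 beta10_iff)
  \<comment> \<open>The images of the factors under \<open>h_map\<close> are determined by
    \<open>t\<close>, and \<open>h_map\<close> is injective on labeled trees, being an involution
    there.\<close>
  have "ss = ?ss" if "gam_decomp ss (h_map t)" for ss
  proof -
    have "map h_map ss = rev (map relabel (children t))"
      using gam_decomp_unique[OF that] beta10 by (simp add: h_h_beta10)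
    then have "map h_map (map h_map ss) = ?ss" by (simp add: rev_map)
    moreover have "map h_map (map h_map ss) = ss"
      using labeled_gam_decomp[OF that]
      by (auto simp: labeled_tree_def h_h_beta10 intro!: map_idI)
    ultimately show ?thesis by simp
  qed
  with ex have "(THE ss. gam_decomp ss (h_map t)) = ?ss" by blast
  \<comment> \<open>\<open>rsub_words\<close> reverses the list and each word. This cancels the
    reversal in \<open>?ss\<close> and, by \<open>preorder_h\<close>, the one that
    \<open>h_map\<close> causes in each word.\<close>
  then show ?thesis
    using adm by (simp add: rsub_words_def sub_words_eq assms rev_map h_map_relabel preorder_h)
qed

section \<open>The identities between the statistics\<close>

lemma leaves_word_eq_int_word_h:
  assumes "labeled_tree t" "has_edge t"
  shows "leaves_word t = int_word (h_map t)"
  using assms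
  by (simp add: labeled_tree_def beta10_iff leaves_word_marked int_word_marked marked_h
      rev_map rev_filter filter_map comp_def)

lemma root_word_eq_rpath_word_h:
  assumes "labeled_tree t" "has_edge t"
  shows "root_word t = rpath_word (h_map t)"
  using assms root_word_h_beta10[of t] labeled_h[of t] rpath_word_eq[of "h_map t"]
  by (simp add: labeled_admissible) (simp add: labeled_tree_def)

theorem theorem7:
  fixes t :: "'a tree"
  assumes "labeled_tree t" and "has_edge t"
  shows "leaves_word t = int_word (h_map t) \<and>
         int_word t = leaves_word (h_map t) \<and>
         root_word t = rpath_word (h_map t) \<and>
         rpath_word t = root_word (h_map t) \<and>
         sub_words t = rsub_words (h_map t) \<and>
         rsub_words t = sub_words (h_map t)"
proof -
  have h: "labeled_tree (h_map t)" "has_edge (h_map t)"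
    using assms by (simp_all add: labeled_h)
  have hh: "h_map (h_map t) = t"
    using assms by (simp add: h_h_beta10 labeled_tree_def)
  show ?thesis
    using assms leaves_word_eq_int_word_h[OF h] root_word_eq_rpath_word_h[OF h]
      rsub_words_h[OF h]
    by (simp add: hh leaves_word_eq_int_word_h root_word_eq_rpath_word_h rsub_words_h)
qed

end
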